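(* There is a polynomial-time algorithm that, given $C,C'\in\mathcal{L}(\geq,\sqcap,\top)$, decides whether $\models C\sqsubseteq C'$.
   Context: $\mathcal{L}(\geq,\sqcap,\top)$ is the set of concepts $C ::= A\mid\top\mid C\sqcap C\mid (\geq k\,R.C)$ with $A$ a concept name, $R$ a role name, $k\ge 1$ (numbers written in binary), interpreted in the standard way: $(\geq k\,R.C)^{\mathcal I}$ is the set of elements with at least $k$ pairwise distinct $R$-successors in $C^{\mathcal I}$. $\models C\sqsubseteq C'$ means $C^{\mathcal I}\subseteq C'^{\mathcal I}$ in every interpretation $\mathcal I$. Running time is measured in $|C|+|C'|$, the number of symbols. *)

theory Defs
  imports "HOL-Computational_Algebra.Polynomial" "HOL-Library.Countable_Set"
begin

section \<open>Syntax and semantics\<close>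

text \<open>Concept names and role names are the members of two countably infinite sets, indexed by binary
  words.  Number restrictions use the type \<^typ>\<open>num\<close> of binary numerals, whose values are
  exactly the integers \<open>k \<ge> 1\<close>.\<close>

type_synonym name = "bool list"

datatype concept =
    Atom name
  | Top
  | And concept concept
  | AtLeast num name concept

record 'd interp =
  domain :: "'d set"
  conc :: "name \<Rightarrow> 'd set"
  role :: "name \<Rightarrow> ('d \<times> 'd) set"

definition is_interp :: "'d interp \<Rightarrow> bool" where
  "is_interp I \<longleftrightarrow> domain I \<noteq> {} \<and> (\<forall>A. conc I A \<subseteq> domain I) \<and>
     (\<forall>R. role I R \<subseteq> domain I \<times> domain I)"

primrec extension :: "'d interp \<Rightarrow> concept \<Rightarrow> 'd set" where
  "extension I (Atom A) = conc I A"
| "extension I Top = domain I"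
| "extension I (And C D) = extension I C \<inter> extension I D"
| "extension I (AtLeast k R C) =
     {x \<in> domain I. \<exists>S. S \<subseteq> {y. (x, y) \<in> role I R \<and> y \<in> extension I C} \<and> finite S \<and> card S = numeral k}"

text \<open>A formula cannot quantify over all types, so the domains range over the nonempty sets of
  natural numbers.  This is no restriction: by \<open>subsumed_iff\<close> below, interpretations over any
  other infinite type give the same relation, and by \<open>subsumed_extension\<close> a subsumption that holds
  here holds in the interpretations over every type.\<close>

definition subsumed :: "concept \<Rightarrow> concept \<Rightarrow> bool" where
  "subsumed C D \<longleftrightarrow> (\<forall>I :: nat interp. is_interp I \<longrightarrow> extension I C \<subseteq> extension I D)"

instance num :: countable by countable_datatype
instance concept :: countable by countable_datatype

lemma extension_transfer:
  fixes I :: "'d interp" and f :: "'d \<Rightarrow> 'e"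
  assumes I: "is_interp I" and S: "S \<subseteq> domain I" and inj: "inj_on f S"
    and closed: "\<And>x k R C. x \<in> S \<Longrightarrow> x \<in> extension I (AtLeast k R C) \<Longrightarrow>
      \<exists>T\<subseteq>S. T \<subseteq> {y. (x, y) \<in> role I R \<and> y \<in> extension I C} \<and> finite T \<and> card T = numeral k"
  defines "J \<equiv> \<lparr>domain = f ` S, conc = (\<lambda>A. f ` (conc I A \<inter> S)),
                role = (\<lambda>R. map_prod f f ` (role I R \<inter> S \<times> S))\<rparr>"
  shows "extension J C = f ` (extension I C \<inter> S)"
proof (induction C)
  case (Atom A)
  show ?case by (simp add: J_def)
next
  case Top
  show ?case using S by (simp add: J_def Int_absorb1)
next
  case (And C D)
  have "f ` (extension I C \<inter> S) \<inter> f ` (extension I D \<inter> S)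
      = f ` ((extension I C \<inter> S) \<inter> (extension I D \<inter> S))"
    using inj_on_image_Int[OF inj, of "extension I C \<inter> S" "extension I D \<inter> S"] by simp
  then show ?case using And by (simp add: Int_ac)
next
  case (AtLeast k R C)
  have succ: "{z. (f x, z) \<in> role J R \<and> z \<in> extension J C} =
      f ` ({y. (x, y) \<in> role I R \<and> y \<in> extension I C} \<inter> S)" if "x \<in> S" for x
  proof -
    have role: "(f x, z) \<in> role J R \<longleftrightarrow> (\<exists>y\<in>S. z = f y \<and> (x, y) \<in> role I R)" for z
    proof
      assume "(f x, z) \<in> role J R"
      then obtain u v where uv: "(u, v) \<in> role I R" "u \<in> S" "v \<in> S" "f x = f u" "z = f v"
        by (auto simp: J_def)
      then have "u = x" using inj_onD[OF inj] that by metis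
      then show "\<exists>y\<in>S. z = f y \<and> (x, y) \<in> role I R" using uv by blast
    next
      assume "\<exists>y\<in>S. z = f y \<and> (x, y) \<in> role I R"
      then obtain y where y: "y \<in> S" "z = f y" "(x, y) \<in> role I R" by blast
      then have "(x, y) \<in> role I R \<inter> S \<times> S" using that by blast
      then have "map_prod f f (x, y) \<in> role J R" unfolding J_def by (simp only: interp.simps imageI)
      then show "(f x, z) \<in> role J R" using y by simp
    qed
    have ext: "f y \<in> extension J C \<longleftrightarrow> y \<in> extension I C" if "y \<in> S" for y
      using that inj_onD[OF inj] unfolding AtLeast by blast
    show ?thesis unfolding role using ext by blast
  qed
  have "f x \<in> extension J (AtLeast k R C) \<longleftrightarrow> x \<in> extension I (AtLeast k R C)" if x: "x \<in> S" for x
  proof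
    assume "f x \<in> extension J (AtLeast k R C)"
    then obtain T where T: "T \<subseteq> f ` ({y. (x, y) \<in> role I R \<and> y \<in> extension I C} \<inter> S)"
        "finite T" "card T = numeral k"
      using succ[OF x] by auto
    then obtain U where U: "U \<subseteq> {y. (x, y) \<in> role I R \<and> y \<in> extension I C} \<inter> S" "T = f ` U"
      by (auto simp: subset_image_iff)
    have "inj_on f U" using U inj by (meson inj_on_subset le_infE)
    then have "finite U" "card U = numeral k"
      using T U by (auto simp: finite_image_iff card_image)
    then show "x \<in> extension I (AtLeast k R C)" using U x S by auto
  next
    assume "x \<in> extension I (AtLeast k R C)"
    then obtain T where T: "T \<subseteq> S" "T \<subseteq> {y. (x, y) \<in> role I R \<and> y \<in> extension I C}"
        "finite T" "card T = numeral k"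
      using closed[OF x, of k R C] by blast
    have "card (f ` T) = numeral k" using T inj by (metis card_image inj_on_subset)
    moreover have "f ` T \<subseteq> {z. (f x, z) \<in> role J R \<and> z \<in> extension J C}"
      unfolding succ[OF x] using T by blast
    moreover have "f x \<in> domain J" using x by (simp add: J_def)
    ultimately show "f x \<in> extension J (AtLeast k R C)"
      unfolding extension.simps mem_Collect_eq using finite_imageI[OF T(3), of f] by blast
  qed
  moreover have "extension J (AtLeast k R C) \<subseteq> f ` S" by (auto simp: J_def)
  ultimately show ?case by blast
qed

lemma extension_subset_domain: "is_interp I \<Longrightarrow> extension I C \<subseteq> domain I"
  by (induction C) (auto simp: is_interp_def)

lemma subsumed_extension:
  fixes I :: "'d interp"
  assumes sub: "subsumed C D" and I: "is_interp I"
  shows "extension I C \<subseteq> extension I D"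
proof
  fix x assume xC: "x \<in> extension I C"
  define W where "W = (\<lambda>y (k, R, E). if y \<in> extension I (AtLeast k R E) then
      (SOME T. T \<subseteq> {z. (y, z) \<in> role I R \<and> z \<in> extension I E} \<and> finite T \<and> card T = numeral k) else {})"
  have W: "W y (k, R, E) \<subseteq> {z. (y, z) \<in> role I R \<and> z \<in> extension I E} \<and> finite (W y (k, R, E)) \<and>
      card (W y (k, R, E)) = numeral k" if "y \<in> extension I (AtLeast k R E)" for y k R E
  proof -
    have "\<exists>T. T \<subseteq> {z. (y, z) \<in> role I R \<and> z \<in> extension I E} \<and> finite T \<and> card T = numeral k"
      using that by simp
    from someI_ex[OF this] show ?thesis using that unfolding W_def by (simp only: prod.case if_True)
  qed
  have Wfin: "finite (W y t) \<and> W y t \<subseteq> domain I" for y t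
  proof (cases t)
    case (fields k R E)
    show ?thesis
    proof (cases "y \<in> extension I (AtLeast k R E)")
      case True
      then show ?thesis using W[OF True] fields extension_subset_domain[OF I, of E] by blast
    next
      case False
      then show ?thesis using fields by (simp add: W_def del: extension.simps)
    qed
  qed
  define F where "F = (\<lambda>n. ((\<lambda>X. \<Union>y\<in>X. \<Union>t. W y t) ^^ n) {x})"
  define S where "S = (\<Union>n. F n)"
  have FS: "F (Suc n) = (\<Union>y\<in>F n. \<Union>t. W y t)" for n by (simp add: F_def)
  have "countable (F n) \<and> F n \<subseteq> domain I" for n
  proof (induction n)
    case 0
    show ?case using xC extension_subset_domain[OF I] by (auto simp: F_def)
  next
    case (Suc n)
    then have "countable (F (Suc n))"
      using Wfin unfolding FS by (intro countable_UN) (simp_all add: countable_finite)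
    moreover have "F (Suc n) \<subseteq> domain I" using Wfin unfolding FS by blast
    ultimately show ?case by blast
  qed
  then have S: "countable S" "S \<subseteq> domain I" by (auto simp: S_def)
  have xS: "x \<in> S" unfolding S_def F_def by (rule UN_I[of 0]) auto
  have SW: "W y t \<subseteq> S" if yS: "y \<in> S" for y t
  proof -
    obtain n where "y \<in> F n" using yS by (auto simp: S_def)
    then have "W y t \<subseteq> F (Suc n)" unfolding FS by blast
    then show ?thesis by (auto simp: S_def)
  qed
  define f where "f = to_nat_on S"
  have inj: "inj_on f S" unfolding f_def using S(1) by (rule inj_on_to_nat_on)
  define J where "J = \<lparr>domain = f ` S, conc = (\<lambda>A. f ` (conc I A \<inter> S)),
                role = (\<lambda>R. map_prod f f ` (role I R \<inter> S \<times> S))\<rparr>"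
  have eq: "extension J E = f ` (extension I E \<inter> S)" for E
    unfolding J_def
  proof (rule extension_transfer[OF I S(2) inj])
    fix y k R E assume "y \<in> S" "y \<in> extension I (AtLeast k R E)"
    then show "\<exists>T\<subseteq>S. T \<subseteq> {z. (y, z) \<in> role I R \<and> z \<in> extension I E} \<and> finite T \<and> card T = numeral k"
      using SW[of y "(k, R, E)"] W[of y k R E] by blast
  qed
  have "is_interp J" using xS by (auto simp: is_interp_def J_def)
  then have "extension J C \<subseteq> extension J D" using sub by (simp add: subsumed_def)
  then have "f x \<in> f ` (extension I D \<inter> S)" using xC xS unfolding eq by blast
  then show "x \<in> extension I D" using inj xS by (auto simp: inj_on_eq_iff)
qed

lemma subsumed_iff:
  assumes inf: "infinite (UNIV :: 'd set)"
  shows "subsumed C D \<longleftrightarrow> (\<forall>I :: 'd interp. is_interp I \<longrightarrow> extension I C \<subseteq> extension I D)"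
proof
  assume "subsumed C D"
  then show "\<forall>I :: 'd interp. is_interp I \<longrightarrow> extension I C \<subseteq> extension I D"
    using subsumed_extension by blast
next
  assume R: "\<forall>I :: 'd interp. is_interp I \<longrightarrow> extension I C \<subseteq> extension I D"
  obtain f :: "nat \<Rightarrow> 'd" where f: "inj f" using inf by (meson infinite_countable_subset)
  show "subsumed C D"
    unfolding subsumed_def
  proof (intro allI impI)
    fix I :: "nat interp" assume I: "is_interp I"
    define S where "S = domain I"
    define J where "J = \<lparr>domain = f ` S, conc = (\<lambda>A. f ` (conc I A \<inter> S)),
                role = (\<lambda>R. map_prod f f ` (role I R \<inter> S \<times> S))\<rparr>"
    have inj: "inj_on f S" using f by (meson inj_on_subset subset_UNIV)
    have eq: "extension J E = f ` (extension I E \<inter> S)" for E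
      unfolding J_def
    proof (rule extension_transfer[OF I _ inj])
      show "S \<subseteq> domain I" by (simp add: S_def)
      fix y k R E assume "y \<in> S" "y \<in> extension I (AtLeast k R E)"
      then obtain T where T: "T \<subseteq> {z. (y, z) \<in> role I R \<and> z \<in> extension I E}" "finite T" "card T = numeral k"
        by auto
      moreover have "T \<subseteq> S" using T(1) extension_subset_domain[OF I, of E] by (auto simp: S_def)
      ultimately show "\<exists>T\<subseteq>S. T \<subseteq> {z. (y, z) \<in> role I R \<and> z \<in> extension I E} \<and> finite T \<and> card T = numeral k"
        by blast
    qed
    have "is_interp J" using I by (auto simp: is_interp_def J_def S_def)
    then have "extension J C \<subseteq> extension J D" using R by blast
    then have "extension I C \<inter> S \<subseteq> extension I D \<inter> S"
      unfolding eq using inj_image_subset_iff[OF f] by simp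
    then show "extension I C \<subseteq> extension I D"
      using extension_subset_domain[OF I, of C] by (auto simp: S_def)
  qed
qed


section \<open>Concepts as words\<close>

text \<open>A concept is written over a finite alphabet as \<open>A\<^bsub>w\<^esub>\<close>, \<open>\<top>\<close>, \<open>(C \<sqinter> D)\<close> or \<open>(\<ge> k R\<^bsub>w\<^esub>. C)\<close>,
  with \<open>w\<close> and \<open>k\<close> in binary.\<close>

datatype letter = Dig bool | LConc | LRole | LTop | LAnd | LGeq | LDot | LOpen | LClose | LSub

text \<open>Most significant digit first.\<close>

primrec digits :: "num \<Rightarrow> bool list" where
  "digits num.One = [True]"
| "digits (num.Bit0 k) = digits k @ [False]"
| "digits (num.Bit1 k) = digits k @ [True]"

primrec word_of :: "concept \<Rightarrow> letter list" where
  "word_of (Atom A) = LConc # map Dig A"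
| "word_of Top = [LTop]"
| "word_of (And C D) = [LOpen] @ word_of C @ [LAnd] @ word_of D @ [LClose]"
| "word_of (AtLeast k R C) =
     [LOpen, LGeq] @ map Dig (digits k) @ [LRole] @ map Dig R @ [LDot] @ word_of C @ [LClose]"

definition csize :: "concept \<Rightarrow> nat" where
  "csize C = length (word_of C)"

definition input_word :: "concept \<Rightarrow> concept \<Rightarrow> letter list" where
  "input_word C D = word_of C @ [LSub] @ word_of D"


section \<open>Deterministic multi-tape Turing machines\<close>

datatype 'a cell = Blank | Input 'a | Work nat

datatype move = MLeft | MStay | MRight

record 'a tm =
  tapes :: nat
  states :: "nat set"
  alphabet :: "'a cell set"
  start :: nat
  accept :: nat
  reject :: nat
  delta :: "nat \<Rightarrow> 'a cell list \<Rightarrow> nat \<times> ('a cell \<times> move) list"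

definition turing_machine :: "'a tm \<Rightarrow> bool" where
  "turing_machine M \<longleftrightarrow>
     tapes M \<ge> 1 \<and> finite (states M) \<and> finite (alphabet M) \<and>
     {start M, accept M, reject M} \<subseteq> states M \<and> accept M \<noteq> reject M \<and>
     Blank \<in> alphabet M \<and> range Input \<subseteq> alphabet M \<and>
     (\<forall>q\<in>states M. \<forall>cs. length cs = tapes M \<and> set cs \<subseteq> alphabet M \<longrightarrow>
        (case delta M q cs of (q', as) \<Rightarrow>
           q' \<in> states M \<and> length as = tapes M \<and> fst ` set as \<subseteq> alphabet M))"

text \<open>Tapes are infinite in both directions; the second component is the head position.\<close>

type_synonym 'a tape = "(int \<Rightarrow> 'a cell) \<times> int"

type_synonym 'a config = "nat \<times> 'a tape list"

fun scanned :: "'a tape \<Rightarrow> 'a cell" where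
  "scanned (t, h) = t h"

fun shift :: "move \<Rightarrow> int \<Rightarrow> int" where
  "shift MLeft h = h - 1"
| "shift MStay h = h"
| "shift MRight h = h + 1"

fun act :: "'a cell \<times> move \<Rightarrow> 'a tape \<Rightarrow> 'a tape" where
  "act (c, m) (t, h) = (t(h := c), shift m h)"

fun step :: "'a tm \<Rightarrow> 'a config \<Rightarrow> 'a config" where
  "step M (q, ts) =
     (if q = accept M \<or> q = reject M then (q, ts)
      else case delta M q (map scanned ts) of (q', as) \<Rightarrow> (q', map2 act as ts))"

definition input_tape :: "'a list \<Rightarrow> 'a tape" where
  "input_tape w = ((\<lambda>i. if 0 \<le> i \<and> i < int (length w) then Input (w ! nat i) else Blank), 0)"

definition initial :: "'a tm \<Rightarrow> 'a list \<Rightarrow> 'a config" where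
  "initial M w = (start M, input_tape w # replicate (tapes M - 1) (input_tape []))"

definition accepts_within :: "'a tm \<Rightarrow> 'a list \<Rightarrow> nat \<Rightarrow> bool" where
  "accepts_within M w n \<longleftrightarrow> (\<exists>t\<le>n. fst ((step M ^^ t) (initial M w)) = accept M)"

definition rejects_within :: "'a tm \<Rightarrow> 'a list \<Rightarrow> nat \<Rightarrow> bool" where
  "rejects_within M w n \<longleftrightarrow> (\<exists>t\<le>n. fst ((step M ^^ t) (initial M w)) = reject M)"

end

theory Submission imports Defs begin

text \<open>\<open>C \<sqsubseteq> D\<close> holds iff every conjunct of \<open>D\<close> is matched by a single conjunct of \<open>C\<close>: a name by the
  same name, and \<open>\<ge> k R. D'\<close> by some \<open>\<ge> l R. C'\<close> with \<open>k \<le> l\<close> and \<open>C' \<sqsubseteq> D'\<close>.  Restrictions of \<open>C\<close> do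
  not add up, because successors required by different conjuncts may be shared; one universal
  interpretation, whose elements each refute a single conjunct and are otherwise as permissive as
  possible, contains all counterexamples.

  This recursion visits each pair of subconcept occurrences at most once.  Since the word of a concept
  determines the parent and the siblings of each occurrence, a machine with one head on each concept
  needs no recursion stack: it walks through the pairs, using a unary counter to match parentheses, so
  that every visit takes linear time and the whole run takes cubic time.\<close>

section \<open>Structural characterisation of subsumption\<close>

primrec conjuncts :: "concept \<Rightarrow> concept set" where
  "conjuncts (Atom A) = {Atom A}"
| "conjuncts Top = {}"
| "conjuncts (And C D) = conjuncts C \<union> conjuncts D"
| "conjuncts (AtLeast k R C) = {AtLeast k R C}"

lemma conjunct_cases:
  assumes "e \<in> conjuncts C"
  obtains (Atom) A where "e = Atom A" | (AtLeast) k R D where "e = AtLeast k R D"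
  using assms by (induction C) auto

lemma conjuncts_conjunct: "e \<in> conjuncts C \<Longrightarrow> conjuncts e = {e}"
  by (induction C) auto

lemma extension_subset_conjunct: "e \<in> conjuncts C \<Longrightarrow> extension I C \<subseteq> extension I e"
  by (induction C) auto

primrec covers :: "concept \<Rightarrow> concept \<Rightarrow> bool" where
  "covers C (Atom A) \<longleftrightarrow> Atom A \<in> conjuncts C"
| "covers C Top \<longleftrightarrow> True"
| "covers C (And D E) \<longleftrightarrow> covers C D \<and> covers C E"
| "covers C (AtLeast k R D) \<longleftrightarrow> (\<exists>l E. AtLeast l R E \<in> conjuncts C \<and> k \<le> l \<and> covers E D)"

lemma covers_iff_conjuncts_right: "covers C D \<longleftrightarrow> (\<forall>e\<in>conjuncts D. covers C e)"
  by (induction D) auto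

lemma covers_iff_conjuncts_left:
  assumes "e \<in> conjuncts D"
  shows "covers C e \<longleftrightarrow> (\<exists>f\<in>conjuncts C. covers f e)"
  using assms by (cases rule: conjunct_cases) (auto simp: conjuncts_conjunct)

lemma extension_AtLeast_mono:
  assumes "k \<le> l" "extension I C \<subseteq> extension I D"
  shows "extension I (AtLeast l R C) \<subseteq> extension I (AtLeast k R D)"
proof
  fix x assume "x \<in> extension I (AtLeast l R C)"
  then obtain S where dom: "x \<in> domain I"
    and successors: "S \<subseteq> {y. (x, y) \<in> role I R \<and> y \<in> extension I C}" "card S = numeral l"
    by auto
  have "numeral k \<le> card S" using assms(1) successors(2) by simp
  then obtain T where "T \<subseteq> S" "card T = numeral k" "finite T"
    using obtain_subset_with_card_n by metis
  then show "x \<in> extension I (AtLeast k R D)" using dom successors(1) assms(2) by auto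
qed

lemma extension_mono_covers:
  assumes "is_interp I"
  shows "covers C D \<Longrightarrow> extension I C \<subseteq> extension I D"
proof (induction D arbitrary: C)
  case (Atom A)
  then show ?case using extension_subset_conjunct[of "Atom A" C] by simp
next
  case Top
  then show ?case by (simp add: extension_subset_domain assms)
next
  case (And D E)
  then show ?case by simp
next
  case (AtLeast k R D)
  then obtain l E where "AtLeast l R E \<in> conjuncts C" "k \<le> l" "covers E D" by auto
  have "extension I C \<subseteq> extension I (AtLeast l R E)"
    using \<open>AtLeast l R E \<in> conjuncts C\<close> by (rule extension_subset_conjunct)
  also have "\<dots> \<subseteq> extension I (AtLeast k R D)"
    using \<open>k \<le> l\<close> AtLeast.IH[OF \<open>covers E D\<close>] by (rule extension_AtLeast_mono)
  finally show ?case .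
qed

lemma extension_AtLeastI:
  fixes f :: "nat \<Rightarrow> 'd"
  assumes "x \<in> domain I" "inj f"
    and "\<And>m. m < numeral k \<Longrightarrow> (x, f m) \<in> role I R \<and> f m \<in> extension I C"
  shows "x \<in> extension I (AtLeast k R C)"
proof -
  let ?S = "f ` {..<numeral k}"
  have "?S \<subseteq> {y. (x, y) \<in> role I R \<and> y \<in> extension I C}" using assms(3) by auto
  moreover have "card ?S = numeral k"
    using inj_on_subset[OF assms(2)] by (simp add: card_image)
  ultimately show ?thesis using assms(1) by auto
qed

lemma notin_extension_AtLeastI:
  assumes "{y. (x, y) \<in> role I R \<and> y \<in> extension I C} \<subseteq> U" "finite U" "card U < numeral k"
  shows "x \<notin> extension I (AtLeast k R C)"
proof
  assume "x \<in> extension I (AtLeast k R C)"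
  then obtain S where "S \<subseteq> {y. (x, y) \<in> role I R \<and> y \<in> extension I C}" "card S = numeral k"
    by auto
  moreover from this have "card S \<le> card U" using assms(1,2) by (intro card_mono) auto
  ultimately show False using assms(3) by simp
qed

text \<open>The element \<open>(Some e, n)\<close> is the most permissive element outside the extension of \<open>e\<close>, and
  \<open>(None, n)\<close> lies in every extension; \<open>n\<close> only provides infinitely many copies.\<close>

fun refuter_succ :: "concept option \<times> nat \<Rightarrow> name \<Rightarrow> (concept option \<times> nat) set" where
  "refuter_succ (Some (AtLeast k R D), n) S =
     (if S = R then {(None, m) |m. Suc m < numeral k} \<union> {(Some e, m) |e m. e \<in> conjuncts D}
      else UNIV)"
| "refuter_succ _ S = UNIV"

definition refuter_model :: "(concept option \<times> nat) interp" where
  "refuter_model = \<lparr>domain = UNIV, conc = (\<lambda>A. {x. fst x \<noteq> Some (Atom A)}),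
     role = (\<lambda>S. {(x, y). y \<in> refuter_succ x S})\<rparr>"

lemma refuter_model_simps [simp]:
  "domain refuter_model = UNIV"
  "x \<in> conc refuter_model A \<longleftrightarrow> fst x \<noteq> Some (Atom A)"
  "(x, y) \<in> role refuter_model S \<longleftrightarrow> y \<in> refuter_succ x S"
  by (simp_all add: refuter_model_def)

lemma is_interp_refuter_model: "is_interp refuter_model"
  by (simp add: is_interp_def refuter_model_def)

lemma None_in_extension: "(None, n) \<in> extension refuter_model C"
proof (induction C arbitrary: n)
  case (AtLeast k R C)
  show ?case by (rule extension_AtLeastI[where f = "Pair None"]) (simp_all add: AtLeast inj_def)
qed simp_all

lemma refuter_notin_extension: "e \<in> conjuncts D \<Longrightarrow> (Some e, n) \<notin> extension refuter_model D"
proof (induction D arbitrary: e n)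
  case (AtLeast k R D)
  let ?U = "Pair (None :: concept option) ` {..<numeral k - 1 :: nat}"
  have "(Some (AtLeast k R D), n) \<notin> extension refuter_model (AtLeast k R D)"
  proof (rule notin_extension_AtLeastI)
    show "{y. ((Some (AtLeast k R D), n), y) \<in> role refuter_model R \<and> y \<in> extension refuter_model D}
        \<subseteq> ?U"
      using AtLeast.IH by auto
    show "card ?U < numeral k" by (simp add: card_image inj_on_def numeral_eq_Suc)
  qed simp
  then show ?case using AtLeast.prems by simp
qed auto

lemma refuter_in_extension:
  "e \<in> conjuncts D \<Longrightarrow> \<not> covers C e \<Longrightarrow> (Some e, n) \<in> extension refuter_model C"
proof (induction C arbitrary: e D n)
  case (And C1 C2)
  have "\<not> covers C1 e" "\<not> covers C2 e"
    using And.prems(2) covers_iff_conjuncts_left[OF And.prems(1)]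
    by (metis UnCI conjuncts.simps(3))+
  then show ?case using And by auto
next
  case (AtLeast l S E)
  obtain e' where successors: "\<And>m. m < numeral l \<Longrightarrow>
      (e', m) \<in> refuter_succ (Some e, n) S \<and> (e', m) \<in> extension refuter_model E"
  proof (cases "\<exists>k D'. e = AtLeast k S D'")
    case False
    then have "refuter_succ (Some e, n) S = UNIV" by (cases e) auto
    then show ?thesis using that[of None] None_in_extension by simp
  next
    case True
    then obtain k D' where e_eq: "e = AtLeast k S D'" by blast
    show ?thesis
    proof (cases "covers E D'")
      case True
      then have "(numeral l :: nat) < numeral k" using AtLeast.prems(2) e_eq by auto
      then have "m < pred_numeral k" if "m < numeral l" for m
        using that by (simp add: numeral_eq_Suc)
      then show ?thesis using that[of None] e_eq None_in_extension by simp
    next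
      case False
      then obtain f where "f \<in> conjuncts D'" "\<not> covers E f"
        using covers_iff_conjuncts_right by blast
      then show ?thesis using that[of "Some f"] e_eq AtLeast.IH by simp
    qed
  qed
  show ?case
    by (rule extension_AtLeastI[where f = "Pair e'"]) (use successors in \<open>simp_all add: inj_def\<close>)
qed auto

theorem subsumed_iff_covers: "subsumed C D \<longleftrightarrow> covers C D"
proof
  assume "subsumed C D"
  then have subset: "extension refuter_model C \<subseteq> extension refuter_model D"
    by (rule subsumed_extension[OF _ is_interp_refuter_model])
  show "covers C D"
  proof (rule ccontr)
    assume "\<not> covers C D"
    then obtain e where "e \<in> conjuncts D" "\<not> covers C e" using covers_iff_conjuncts_right by blast
    then show False using subset refuter_in_extension refuter_notin_extension by blast
  qed
next
  assume "covers C D"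
  then show "subsumed C D" by (simp add: subsumed_def extension_mono_covers)
qed


section \<open>The Turing machine\<close>

text \<open>The machine decides \<open>C \<sqsubseteq> D\<close> with one head on \<open>C\<close> (side \<open>Lhs\<close>) and one on \<open>D\<close> (side \<open>Rhs\<close>).\<close>

datatype side = Lhs | Rhs

datatype control =
    Start | Copy | Rewind
  | Enter side | Peek side | Match | CompareNum "bool option" | CompareName bool | Back side bool
  | Return side bool | Ascend side bool | Sibling side | Parent side bool
  | Halt bool

instance side :: finite
proof
  have "UNIV = {Lhs, Rhs}" by (auto intro: side.exhaust)
  then show "finite (UNIV :: side set)" by (metis finite.emptyI finite.insertI)
qed

instance letter :: finite
proof
  have "UNIV \<subseteq> range Dig \<union> {LConc, LRole, LTop, LAnd, LGeq, LDot, LOpen, LClose, LSub}"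
  proof
    fix a show "a \<in> range Dig \<union> {LConc, LRole, LTop, LAnd, LGeq, LDot, LOpen, LClose, LSub}"
      by (cases a) simp_all
  qed
  then show "finite (UNIV :: letter set)" by (rule finite_subset) simp
qed

instance control :: finite
proof
  let ?S = "{Start, Copy, Rewind, Match} \<union> range Enter \<union> range Peek \<union> range CompareNum \<union>
    range CompareName \<union> range (case_prod Back) \<union> range (case_prod Return) \<union>
    range (case_prod Ascend) \<union> range Sibling \<union> range (case_prod Parent) \<union> range Halt"
  have "UNIV \<subseteq> ?S"
  proof
    fix q show "q \<in> ?S" by (cases q) (simp_all add: image_iff)
  qed
  then show "finite (UNIV :: control set)" by (rule finite_subset) simp
qed

definition is_digit :: "letter cell \<Rightarrow> bool" where
  "is_digit c \<longleftrightarrow> (\<exists>b. c = Input (Dig b))"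

definition leaf_openers :: "letter cell set" where
  "leaf_openers = {Input LOpen, Input LConc}"

text \<open>The verdict on a single conjunct that settles the traversal of a side: one conjunct of \<open>C\<close> that
  matches suffices, and one conjunct of \<open>D\<close> that is not matched suffices.\<close>

primrec decisive :: "side \<Rightarrow> bool" where
  "decisive Lhs = True"
| "decisive Rhs = False"

primrec leaf_control :: "side \<Rightarrow> control" where
  "leaf_control Rhs = Enter Lhs"
| "leaf_control Lhs = Match"

abbreviation stay :: "side \<Rightarrow> move" where
  "stay \<equiv> \<lambda>_. MStay"

text \<open>The arguments are the cells \<open>x s\<close> scanned on the two concept tapes and the cell \<open>z\<close> scanned on
  the counter tape, whose only nonblank cell is the origin.  A node of a concept is addressed by the
  position of its first letter; the letter to the left of that position shows whether the node is a
  left conjunct (\<open>LOpen\<close>), a right conjunct (\<open>LAnd\<close>), the body of a restriction (\<open>LDot\<close>) or the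
  root.  The comparisons read numerals and names to their ends even after a difference, so that the
  final head positions do not depend on the outcome.\<close>

primrec transition ::
    "control \<Rightarrow> (side \<Rightarrow> letter cell) \<Rightarrow> letter cell \<Rightarrow> control \<times> (side \<Rightarrow> move) \<times> move" where
  "transition Start x z = (Copy, stay, MStay)"
| "transition Copy x z =
     (if x Rhs = Input LSub then (Rewind, stay(Rhs := MRight, Lhs := MLeft), MStay)
      else (Copy, \<lambda>_. MRight, MStay))"
| "transition Rewind x z =
     (if x Lhs = Blank then (Enter Rhs, stay(Lhs := MRight), MStay)
      else (Rewind, stay(Lhs := MLeft), MStay))"
| "transition (Enter s) x z =
     (if x s = Input LTop then (Return s (\<not> decisive s), stay, MStay)
      else if x s = Input LOpen then (Peek s, stay(s := MRight), MStay)
      else (leaf_control s, stay, MStay))"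
| "transition (Peek s) x z =
     (if x s = Input LGeq then (leaf_control s, stay(s := MLeft), MStay)
      else (Enter s, stay, MStay))"
| "transition Match x z =
     (if x Lhs \<noteq> x Rhs then (Return Lhs False, stay, MStay)
      else (if x Lhs = Input LOpen then CompareNum None else CompareName True, \<lambda>_. MRight, MStay))"
| "transition (CompareNum c) x z =
     (if x Lhs = Input LRole then
        if x Rhs = Input LRole then (CompareName (c \<noteq> Some False), \<lambda>_. MRight, MStay)
        else (CompareNum (Some False), stay(Rhs := MRight), MStay)
      else if x Rhs = Input LRole then (CompareNum (Some True), stay(Lhs := MRight), MStay)
      else (CompareNum (if c = None \<and> x Lhs \<noteq> x Rhs then Some (x Lhs = Input (Dig True)) else c),
        \<lambda>_. MRight, MStay))"
| "transition (CompareName b) x z =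
     (if is_digit (x Lhs) \<or> is_digit (x Rhs) then
        (CompareName (b \<and> x Lhs = x Rhs), \<lambda>s. if is_digit (x s) then MRight else MStay, MStay)
      else if b \<and> x Lhs = Input LDot then (Enter Rhs, \<lambda>_. MRight, MStay)
      else (Back Lhs b, stay, MStay))"
| "transition (Back s b) x z =
     (if x s \<in> leaf_openers then (if s = Lhs then Back Rhs b else Return Lhs b, stay, MStay)
      else (Back s b, stay(s := MLeft), MStay))"
| "transition (Return s b) x z = (Ascend s b, stay(s := MLeft), MStay)"
| "transition (Ascend s b) x z =
     (if x s = Input LOpen then
        if b = decisive s then (Return s b, stay, MStay) else (Sibling s, stay(s := MRight), MStay)
      else if x s = Input LAnd then (Parent s b, stay(s := MLeft), MStay)
      else if s = Lhs then (Return Rhs b, stay(Lhs := MRight), MStay)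
      else if x s = Input LDot then (Back Lhs b, stay(Lhs := MLeft), MStay)
      else (Halt b, stay, MStay))"
| "transition (Sibling s) x z =
     (if x s = Input LAnd \<and> z \<noteq> Blank then (Enter s, stay(s := MRight), MStay)
      else (Sibling s, stay(s := MRight),
        if x s = Input LOpen then MRight else if x s = Input LClose then MLeft else MStay))"
| "transition (Parent s b) x z =
     (if x s = Input LOpen \<and> z \<noteq> Blank then (Return s b, stay, MStay)
      else (Parent s b, stay(s := MLeft),
        if x s = Input LOpen then MLeft else if x s = Input LClose then MRight else MStay))"
| "transition (Halt b) x z = (Halt b, stay, MStay)"

definition subsumption_tm :: "letter tm" where
  "subsumption_tm = \<lparr>tapes = 3, states = range (to_nat :: control \<Rightarrow> nat),
     alphabet = {Blank, Work 0} \<union> range Input,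
     start = to_nat Start, accept = to_nat (Halt True), reject = to_nat (Halt False),
     delta = (\<lambda>q cs.
       let x = case_side (cs ! 1) (cs ! 0)
       in case transition (from_nat q) x (cs ! 2) of (q', m, m') \<Rightarrow>
         (to_nat q',
          [(x Rhs, m Rhs),
           (if from_nat q = Copy \<and> x Rhs \<noteq> Input LSub then x Rhs else x Lhs, m Lhs),
           (if from_nat q = Start then Work 0 else cs ! 2, m')]))\<rparr>"

lemma turing_machine_subsumption_tm: "turing_machine subsumption_tm"
proof -
  have "case delta subsumption_tm q cs of (q', as) \<Rightarrow>
      q' \<in> states subsumption_tm \<and> length as = tapes subsumption_tm \<and>
      fst ` set as \<subseteq> alphabet subsumption_tm"
    if "length cs = tapes subsumption_tm" and symbols: "set cs \<subseteq> alphabet subsumption_tm" for q cs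
  proof -
    have "length cs = Suc (Suc (Suc 0))" using that(1) by (simp add: subsumption_tm_def)
    then obtain x y z where "cs = [x, y, z]" by (auto simp: length_Suc_conv)
    then show ?thesis using symbols by (auto simp: subsumption_tm_def Let_def split: prod.split)
  qed
  then show ?thesis unfolding turing_machine_def by (auto simp: subsumption_tm_def)
qed


section \<open>Runs of bounded length\<close>

definition reaches :: "'a tm \<Rightarrow> nat \<Rightarrow> 'a config \<Rightarrow> 'a config \<Rightarrow> bool" where
  "reaches M n a b \<longleftrightarrow> (\<exists>m\<le>n. (step M ^^ m) a = b)"

lemma reaches_refl: "reaches M 0 a a"
  by (simp add: reaches_def)

lemma reaches_step: "step M a = b \<Longrightarrow> reaches M 1 a b"
  unfolding reaches_def by (intro exI[of _ 1]) simp

lemma reaches_trans [trans]: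
  assumes "reaches M m a b" "reaches M n b c"
  shows "reaches M (m + n) a c"
proof -
  obtain p q where "p \<le> m" "(step M ^^ p) a = b" "q \<le> n" "(step M ^^ q) b = c"
    using assms by (auto simp: reaches_def)
  then have "q + p \<le> m + n" "(step M ^^ (q + p)) a = c" by (simp_all add: funpow_add)
  then show ?thesis unfolding reaches_def by blast
qed

lemma reaches_cong: "reaches M m a b \<Longrightarrow> m \<le> n \<Longrightarrow> a = a' \<Longrightarrow> b = b' \<Longrightarrow> reaches M n a' b'"
  unfolding reaches_def using le_trans by blast

lemma reaches_mono: "reaches M m a b \<Longrightarrow> m \<le> n \<Longrightarrow> reaches M n a b"
  by (erule reaches_cong) simp_all

abbreviation reach :: "nat \<Rightarrow> letter config \<Rightarrow> letter config \<Rightarrow> bool" where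
  "reach \<equiv> reaches subsumption_tm"


section \<open>Words on tapes\<close>

definition word_at :: "(int \<Rightarrow> letter cell) \<Rightarrow> int \<Rightarrow> letter list \<Rightarrow> bool" where
  "word_at t i u \<longleftrightarrow> (\<forall>m<length u. t (i + int m) = Input (u ! m))"

lemma word_at_Nil [simp]: "word_at t i []"
  by (simp add: word_at_def)

lemma word_at_Cons [simp]: "word_at t i (a # u) \<longleftrightarrow> t i = Input a \<and> word_at t (i + 1) u"
  by (auto simp: word_at_def less_Suc_eq_0_disj algebra_simps)

lemma word_at_append [simp]:
  "word_at t i (u @ v) \<longleftrightarrow> word_at t i u \<and> word_at t (i + int (length u)) v"
  by (induction u arbitrary: i) (auto simp: algebra_simps)

lemma word_at_cell_in:
  assumes "word_at t i u" "i \<le> p" "p < i + int (length u)"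
  shows "t p \<in> Input ` set u"
proof -
  have "p = i + int (nat (p - i))" "nat (p - i) < length u" using assms(2,3) by auto
  then show ?thesis using assms(1) unfolding word_at_def by (metis imageI nth_mem)
qed

lemma csize_simps [simp]:
  "csize (Atom A) = Suc (length A)"
  "csize Top = 1"
  "csize (And C D) = csize C + csize D + 3"
  "csize (AtLeast k R C) = length (digits k) + length R + csize C + 5"
  by (simp_all add: csize_def)

lemma le_mult_csize: "n \<le> n * csize C"
  by (cases C) simp_all

lemma csize_conjunct_le: "e \<in> conjuncts C \<Longrightarrow> csize e \<le> csize C"
  by (induction C) auto

lemma word_at_word_of_hd:
  assumes "word_at t i (word_of C)"
  shows "t i \<in> Input ` {LConc, LTop, LOpen}"
  using assms by (cases C) auto

fun bracket_level :: "letter \<Rightarrow> int" where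
  "bracket_level LOpen = 1"
| "bracket_level LClose = - 1"
| "bracket_level _ = 0"

abbreviation depth :: "letter list \<Rightarrow> int" where
  "depth u \<equiv> sum_list (map bracket_level u)"

text \<open>A scan for the right conjunct or for the parent of a node stops at level 0; it crosses a word
  that is nested at level \<open>k\<close> without stopping if it enters the word at level \<open>k\<close>.\<close>

primrec nested :: "int \<Rightarrow> letter list \<Rightarrow> bool" where
  "nested k [] \<longleftrightarrow> True"
| "nested k (a # u) \<longleftrightarrow>
     0 \<le> k + bracket_level a \<and> (a = LAnd \<longrightarrow> 0 < k) \<and> nested (k + bracket_level a) u"

lemma nested_append [simp]: "nested k (u @ v) \<longleftrightarrow> nested k u \<and> nested (k + depth u) v"
  by (induction u arbitrary: k) (auto simp: add.assoc)

lemma depth_map_Dig [simp]: "depth (map Dig w) = 0"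
  by (induction w) simp_all

lemma nested_map_Dig [simp]: "0 \<le> k \<Longrightarrow> nested k (map Dig w)"
  by (induction w) simp_all

lemma depth_word_of [simp]: "depth (word_of C) = 0"
  by (induction C) (simp_all del: map_map)

lemma nested_word_of: "0 \<le> k \<Longrightarrow> nested k (word_of C)"
  by (induction C arbitrary: k) (simp_all del: map_map)


section \<open>Comparison of binary numerals\<close>

text \<open>The first argument is the outcome at the first digit that differed, if any; a longer numeral is
  greater because numerals have no leading zeros.\<close>

fun digits_ge :: "bool option \<Rightarrow> bool list \<Rightarrow> bool list \<Rightarrow> bool" where
  "digits_ge c (a # u) (b # v) = digits_ge (if c = None \<and> a \<noteq> b then Some a else c) u v"
| "digits_ge c (a # u) [] = digits_ge (Some True) u []"
| "digits_ge c [] (b # v) = digits_ge (Some False) [] v"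
| "digits_ge c [] [] \<longleftrightarrow> c \<noteq> Some False"

abbreviation binary_value :: "bool list \<Rightarrow> nat" where
  "binary_value u \<equiv> horner_sum of_bool 2 (rev u)"

lemma binary_value_less: "binary_value u < 2 ^ length u"
  using horner_sum_of_bool_2_less[of "rev u"] by simp

lemma binary_value_digits: "binary_value (digits k) = numeral k"
  by (induction k) (simp_all add: numeral_Bit0 numeral_Bit1)

lemma digits_eq_True_Cons: "\<exists>u. digits k = True # u"
  by (induction k) auto

lemma length_digits_mono:
  assumes "l \<le> k"
  shows "length (digits l) \<le> length (digits k)"
proof (rule ccontr)
  assume less: "\<not> length (digits l) \<le> length (digits k)"
  obtain u where digits_l: "digits l = True # u" using digits_eq_True_Cons by blast
  have "binary_value (digits k) < 2 ^ length (digits k)" by (rule binary_value_less)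
  also have "\<dots> \<le> 2 ^ length u" using less digits_l by (intro power_increasing) auto
  also have "\<dots> \<le> binary_value (digits l)" using digits_l by (simp add: horner_sum_append)
  finally show False using assms by (simp add: binary_value_digits)
qed

lemma digits_ge_decided: "length u = length v \<Longrightarrow> digits_ge (Some b) u v \<longleftrightarrow> b"
  by (induction u v rule: list_induct2) auto

lemma digits_ge_same_length:
  "length u = length v \<Longrightarrow> digits_ge None u v \<longleftrightarrow> binary_value v \<le> binary_value u"
proof (induction u v rule: list_induct2)
  case (Cons a u b v)
  then show ?case
    using binary_value_less[of u] binary_value_less[of v]
    by (auto simp: digits_ge_decided horner_sum_append)
qed simp

lemma digits_ge_longer: "length v < length u \<Longrightarrow> digits_ge c u v"
proof (induction c u v rule: digits_ge.induct)
  case (2 c a u)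
  then show ?case by (cases u) auto
qed auto

lemma digits_ge_shorter: "length u < length v \<Longrightarrow> \<not> digits_ge c u v"
proof (induction c u v rule: digits_ge.induct)
  case (3 c b v)
  then show ?case by (cases v) auto
qed auto

lemma digits_ge_digits: "digits_ge None (digits k) (digits l) \<longleftrightarrow> l \<le> k"
proof (cases "length (digits k)" "length (digits l)" rule: linorder_cases)
  case less
  then show ?thesis using length_digits_mono[of l k] by (auto simp: digits_ge_shorter)
next
  case equal
  then show ?thesis by (simp add: digits_ge_same_length binary_value_digits)
next
  case greater
  then show ?thesis using length_digits_mono[of k l] linear[of k l] by (auto simp: digits_ge_longer)
qed


section \<open>Correctness and running time\<close>

definition origin_mark :: "int \<Rightarrow> letter cell" where
  "origin_mark = (\<lambda>_. Blank)(0 := Work 0)"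

lemma origin_mark_eq_Blank [simp]: "origin_mark k = Blank \<longleftrightarrow> k \<noteq> 0"
  by (simp add: origin_mark_def)

lemma side_fun_eq_iff: "f = g \<longleftrightarrow> f Lhs = g Lhs \<and> f Rhs = g Rhs"
  by (metis ext side.exhaust)

primrec heads :: "int \<Rightarrow> int \<Rightarrow> side \<Rightarrow> int" where
  "heads j i Lhs = j"
| "heads j i Rhs = i"

lemma heads_upd [simp]: "(heads j i)(Lhs := j') = heads j' i" "(heads j i)(Rhs := i') = heads j i'"
  by (simp_all add: side_fun_eq_iff)

definition shift_heads :: "(side \<Rightarrow> move) \<Rightarrow> (side \<Rightarrow> int) \<Rightarrow> side \<Rightarrow> int" where
  "shift_heads m h = (\<lambda>s. shift (m s) (h s))"

lemma shift_heads_simps [simp]: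
  "shift_heads stay h = h"
  "shift_heads (stay(s := m)) h = h(s := shift m (h s))"
  "shift_heads m' (heads j i) = heads (shift (m' Lhs) j) (shift (m' Rhs) i)"
  by (auto simp: shift_heads_def side_fun_eq_iff)

text \<open>The induction method eta-expands the head positions; with \<open>fun_upd_apply\<close>, the simplifier would
  then turn them into conditional expressions.\<close>

context
  fixes T :: "side \<Rightarrow> int \<Rightarrow> letter cell"
  notes [simp del] = fun_upd_apply and [simp] = fun_upd_same fun_upd_other
begin

definition config :: "control \<Rightarrow> (side \<Rightarrow> int) \<Rightarrow> int \<Rightarrow> letter config" where
  "config q h k = (to_nat q, [(T Rhs, h Rhs), (T Lhs, h Lhs), (origin_mark, k)])"

abbreviation conf :: "control \<Rightarrow> (side \<Rightarrow> int) \<Rightarrow> letter config" where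
  "conf q h \<equiv> config q h 0"

lemma step_config:
  assumes "q \<noteq> Start" "q \<noteq> Copy" "\<And>b. q \<noteq> Halt b"
  shows "step subsumption_tm (config q h k) =
    (case transition q (\<lambda>s. T s (h s)) (origin_mark k) of
      (q', m, m') \<Rightarrow> config q' (shift_heads m h) (shift m' k))"
proof -
  have "case_side (T Lhs (h Lhs)) (T Rhs (h Rhs)) = (\<lambda>s. T s (h s))"
    by (simp add: side_fun_eq_iff)
  then show ?thesis
    using assms by (auto simp: config_def subsumption_tm_def shift_heads_def split: prod.split)
qed

definition node :: "side \<Rightarrow> int \<Rightarrow> concept \<Rightarrow> bool" where
  "node s i C \<longleftrightarrow> word_at (T s) i (word_of C) \<and>
     T s (i + int (csize C)) \<in> {Blank, Input LAnd, Input LClose, Input LSub}"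

lemma node_AndD:
  assumes "node s i (And C D)"
  shows "T s i = Input LOpen" "node s (i + 1) C" "T s (i + 1 + int (csize C)) = Input LAnd"
    "node s (i + 1 + int (csize C) + 1) D"
  using assms by (simp_all add: node_def csize_def add_ac)


subsection \<open>Walking through the conjuncts of a concept\<close>

lemma reach_Sibling_scan:
  "nested k u \<Longrightarrow> word_at (T s) i u \<Longrightarrow>
   reach (length u) (config (Sibling s) (h(s := i)) k)
     (config (Sibling s) (h(s := i + int (length u))) (k + depth u))"
proof (induction u arbitrary: i k)
  case (Cons a u)
  have "reach 1 (config (Sibling s) (h(s := i)) k)
      (config (Sibling s) (h(s := i + 1)) (k + bracket_level a))"
    using Cons.prems by (intro reaches_step) (cases a; auto simp: step_config)
  also have "reach (length u) \<dots>
      (config (Sibling s) (h(s := i + 1 + int (length u))) (k + bracket_level a + depth u))"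
    using Cons.prems by (intro Cons.IH) simp_all
  finally show ?case by (rule reaches_cong) (simp_all add: algebra_simps)
qed (simp add: reaches_refl)

lemma reach_Parent_scan:
  "nested k u \<Longrightarrow> 0 \<le> k \<Longrightarrow> word_at (T s) (i + 1) u \<Longrightarrow>
   reach (length u) (config (Parent s b) (h(s := i + int (length u))) (k + depth u))
     (config (Parent s b) (h(s := i)) k)"
proof (induction u arbitrary: i k)
  case (Cons a u)
  have "reach (length u)
      (config (Parent s b) (h(s := i + 1 + int (length u))) (k + bracket_level a + depth u))
      (config (Parent s b) (h(s := i + 1)) (k + bracket_level a))"
    using Cons.prems by (intro Cons.IH) simp_all
  also have "reach 1 \<dots> (config (Parent s b) (h(s := i)) k)"
    using Cons.prems by (intro reaches_step) (cases a; auto simp: step_config)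
  finally show ?case by (rule reaches_cong) (simp_all add: algebra_simps)
qed (simp add: reaches_refl)

lemma reach_Enter_left_conjunct:
  assumes "node s i (And C D)"
  shows "reach 2 (conf (Enter s) (h(s := i))) (conf (Enter s) (h(s := i + 1)))"
proof -
  note parts = node_AndD[OF assms]
  have "T s (i + 1) \<noteq> Input LGeq"
    using parts(2) word_at_word_of_hd[of "T s" "i + 1" C] by (auto simp: node_def)
  have "reach 1 (conf (Enter s) (h(s := i))) (conf (Peek s) (h(s := i + 1)))"
    using parts(1) by (intro reaches_step) (simp add: step_config)
  also have "reach 1 \<dots> (conf (Enter s) (h(s := i + 1)))"
    using \<open>T s (i + 1) \<noteq> Input LGeq\<close> by (intro reaches_step) (simp add: step_config)
  finally show ?thesis by (simp add: numeral_2_eq_2)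
qed

lemma reach_Return_left_conjunct:
  assumes "node s i (And C D)" "b = decisive s"
  shows "reach 2 (conf (Return s b) (h(s := i + 1))) (conf (Return s b) (h(s := i)))"
proof -
  have "reach 1 (conf (Return s b) (h(s := i + 1))) (conf (Ascend s b) (h(s := i)))"
    by (intro reaches_step) (simp add: step_config)
  also have "reach 1 \<dots> (conf (Return s b) (h(s := i)))"
    using node_AndD(1)[OF assms(1)] assms(2) by (intro reaches_step) (simp add: step_config)
  finally show ?thesis by (simp add: numeral_2_eq_2)
qed

lemma reach_Enter_right_conjunct:
  assumes "node s i (And C D)" "b \<noteq> decisive s"
  shows "reach (csize C + 3) (conf (Return s b) (h(s := i + 1)))
    (conf (Enter s) (h(s := i + 1 + int (csize C) + 1)))"
proof -
  note parts = node_AndD[OF assms(1)]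
  have "reach 1 (conf (Return s b) (h(s := i + 1))) (conf (Ascend s b) (h(s := i)))"
    by (intro reaches_step) (simp add: step_config)
  also have "reach 1 \<dots> (conf (Sibling s) (h(s := i + 1)))"
    using parts(1) assms(2) by (intro reaches_step) (simp add: step_config)
  also have "reach (csize C) \<dots> (conf (Sibling s) (h(s := i + 1 + int (csize C))))"
    using reach_Sibling_scan[OF nested_word_of, of 0 s "i + 1" C h] parts(2)
    by (simp add: node_def csize_def)
  also have "reach 1 \<dots> (conf (Enter s) (h(s := i + 1 + int (csize C) + 1)))"
    using parts(3) by (intro reaches_step) (simp add: step_config)
  finally show ?thesis by (rule reaches_mono) simp
qed

lemma reach_Return_right_conjunct:
  assumes "node s i (And C D)"
  shows "reach (csize C + 3) (conf (Return s b) (h(s := i + 1 + int (csize C) + 1)))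
    (conf (Return s b) (h(s := i)))"
proof -
  note parts = node_AndD[OF assms]
  let ?j = "i + 1 + int (csize C)"
  have "reach 1 (conf (Return s b) (h(s := ?j + 1))) (conf (Ascend s b) (h(s := ?j)))"
    by (intro reaches_step) (simp add: step_config add_ac)
  also have "reach 1 \<dots> (conf (Parent s b) (h(s := i + int (csize C))))"
    using parts(3) by (intro reaches_step) (simp add: step_config)
  also have "reach (csize C) \<dots> (conf (Parent s b) (h(s := i)))"
    using reach_Parent_scan[OF nested_word_of, of 0 s i C b h] parts(2)
    by (simp add: node_def csize_def)
  also have "reach 1 \<dots> (conf (Return s b) (h(s := i)))"
    using parts(1) by (intro reaches_step) (simp add: step_config)
  finally show ?thesis by (rule reaches_mono) simp
qed

lemma reach_Enter_And:
  assumes node: "node s i (And C D)"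
    and left: "reach m (conf (Enter s) (h(s := i + 1))) (conf (Return s b) (h(s := i + 1)))"
    and right: "reach n (conf (Enter s) (h(s := i + 1 + int (csize C) + 1)))
      (conf (Return s b') (h(s := i + 1 + int (csize C) + 1)))"
  shows "reach (m + n + 2 * csize C + 8) (conf (Enter s) (h(s := i)))
    (conf (Return s (if b = decisive s then b else b')) (h(s := i)))"
proof (cases "b = decisive s")
  case True
  note reach_Enter_left_conjunct[OF node]
  also note left
  also note reach_Return_left_conjunct[OF node True]
  finally show ?thesis by (rule reaches_cong) (use True in simp_all)
next
  case False
  note reach_Enter_left_conjunct[OF node]
  also note left
  also note reach_Enter_right_conjunct[OF node False]
  also note right
  also note reach_Return_right_conjunct[OF node]
  finally show ?thesis by (rule reaches_cong) (use False in simp_all)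
qed

primrec over_conjuncts :: "side \<Rightarrow> concept set \<Rightarrow> (concept \<Rightarrow> bool) \<Rightarrow> bool" where
  "over_conjuncts Lhs = Bex"
| "over_conjuncts Rhs = Ball"

lemma over_conjuncts_simps [simp]:
  "over_conjuncts s {} P \<longleftrightarrow> \<not> decisive s"
  "over_conjuncts s {e} P \<longleftrightarrow> P e"
  "over_conjuncts s (X \<union> Y) P \<longleftrightarrow>
     (if over_conjuncts s X P = decisive s then over_conjuncts s X P else over_conjuncts s Y P)"
  by (cases s; auto)+

lemma reach_Enter_conjuncts:
  assumes "node s i C" "2 * csize C + 8 \<le> K"
    and "\<And>e i. e \<in> conjuncts C \<Longrightarrow> node s i e \<Longrightarrow>
      reach (K * csize e) (conf (Enter s) (h(s := i))) (conf (Return s (P e)) (h(s := i)))"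
  shows "reach (K * csize C) (conf (Enter s) (h(s := i)))
    (conf (Return s (over_conjuncts s (conjuncts C) P)) (h(s := i)))"
  using assms
proof (induction C arbitrary: i)
  case Top
  have "reach 1 (conf (Enter s) (h(s := i))) (conf (Return s (\<not> decisive s)) (h(s := i)))"
    using Top.prems(1) by (intro reaches_step) (simp add: step_config node_def)
  then show ?case by (rule reaches_cong) (use Top.prems(2) in simp_all)
next
  case (And C D)
  let ?P = "\<lambda>C. over_conjuncts s (conjuncts C) P" and ?j = "i + 1 + int (csize C) + 1"
  note node = And.prems(1)
  have "K * csize (And C D) = K * csize C + K * csize D + K * 3" by (simp add: distrib_left)
  then have time: "K * csize C + K * csize D + 2 * csize C + 8 \<le> K * csize (And C D)"
    using And.prems(2) by simp
  have "reach (K * csize C) (conf (Enter s) (h(s := i + 1)))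
      (conf (Return s (?P C)) (h(s := i + 1)))"
    using And.prems by (intro And.IH(1) node_AndD[OF node]) auto
  moreover
  have "reach (K * csize D) (conf (Enter s) (h(s := ?j))) (conf (Return s (?P D)) (h(s := ?j)))"
    using And.prems by (intro And.IH(2) node_AndD[OF node]) auto
  ultimately show ?case
    by (rule reaches_cong[OF reach_Enter_And[OF node]]) (use time in simp_all)
qed simp_all


subsection \<open>Comparing two conjuncts\<close>

lemma reach_CompareNum:
  "word_at (T Lhs) j (map Dig u @ [LRole]) \<Longrightarrow> word_at (T Rhs) i (map Dig v @ [LRole]) \<Longrightarrow>
   reach (length u + length v + 1) (conf (CompareNum c) (heads j i))
     (conf (CompareName (digits_ge c u v))
       (heads (j + int (length u) + 1) (i + int (length v) + 1)))"
proof (induction c u v arbitrary: i j rule: digits_ge.induct)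
  case (1 c a u b v)
  have "reach 1 (conf (CompareNum c) (heads j i))
      (conf (CompareNum (if c = None \<and> a \<noteq> b then Some a else c)) (heads (j + 1) (i + 1)))"
    using "1.prems" by (intro reaches_step) (auto simp: step_config)
  also note "1.IH"[of "j + 1" "i + 1"]
  finally show ?case by (rule reaches_cong) (use "1.prems" in simp_all)
next
  case (2 c a u)
  have "reach 1 (conf (CompareNum c) (heads j i)) (conf (CompareNum (Some True)) (heads (j + 1) i))"
    using "2.prems" by (intro reaches_step) (auto simp: step_config)
  also note "2.IH"[of "j + 1" i]
  finally show ?case by (rule reaches_cong) (use "2.prems" in simp_all)
next
  case (3 c b v)
  have "reach 1 (conf (CompareNum c) (heads j i)) (conf (CompareNum (Some False)) (heads j (i + 1)))"
    using "3.prems" by (intro reaches_step) (auto simp: step_config)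
  also note "3.IH"[of j "i + 1"]
  finally show ?case by (rule reaches_cong) (use "3.prems" in simp_all)
next
  case (4 c)
  then have "reach 1 (conf (CompareNum c) (heads j i))
      (conf (CompareName (c \<noteq> Some False)) (heads (j + 1) (i + 1)))"
    by (intro reaches_step) (simp add: step_config)
  then show ?case by simp
qed

lemma reach_CompareName:
  "word_at (T Lhs) j (map Dig A) \<Longrightarrow> \<not> is_digit (T Lhs (j + int (length A))) \<Longrightarrow>
   word_at (T Rhs) i (map Dig B) \<Longrightarrow> \<not> is_digit (T Rhs (i + int (length B))) \<Longrightarrow>
   reach (length A + length B) (conf (CompareName b) (heads j i))
     (conf (CompareName (b \<and> A = B)) (heads (j + int (length A)) (i + int (length B))))"
proof (induction A arbitrary: b j i B)
  case Nil
  then show ?case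
  proof (induction B arbitrary: b i)
    case (Cons y B)
    have "reach 1 (conf (CompareName b) (heads j i)) (conf (CompareName False) (heads j (i + 1)))"
      using Cons.prems by (intro reaches_step) (auto simp: step_config is_digit_def)
    also note Cons.IH[of "i + 1" False]
    finally show ?case by (rule reaches_cong) (use Cons.prems in \<open>simp_all add: add_ac\<close>)
  qed (simp add: reaches_refl)
next
  case (Cons x A)
  show ?case
  proof (cases B)
    case Nil
    then have "\<not> is_digit (T Rhs i)" using Cons.prems by simp
    then have "Input (Dig x) \<noteq> T Rhs i" by (metis is_digit_def)
    then have "reach 1 (conf (CompareName b) (heads j i))
        (conf (CompareName False) (heads (j + 1) i))"
      using Cons.prems Nil by (intro reaches_step) (simp add: step_config is_digit_def)
    also note Cons.IH[of "j + 1" i "[]" False]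
    finally show ?thesis by (rule reaches_cong) (use Cons.prems Nil in \<open>simp_all add: add_ac\<close>)
  next
    case B_Cons: (Cons y B')
    have "reach 1 (conf (CompareName b) (heads j i))
        (conf (CompareName (b \<and> x = y)) (heads (j + 1) (i + 1)))"
      using Cons.prems B_Cons by (intro reaches_step) (auto simp: step_config is_digit_def)
    also note Cons.IH[of "j + 1" "i + 1" B' "b \<and> x = y"]
    finally show ?thesis by (rule reaches_cong) (use Cons.prems B_Cons in \<open>auto simp: add_ac\<close>)
  qed
qed

definition leaf_prefix :: "side \<Rightarrow> int \<Rightarrow> nat \<Rightarrow> bool" where
  "leaf_prefix s i n \<longleftrightarrow>
     T s i \<in> leaf_openers \<and> (\<forall>p. i < p \<and> p \<le> i + int n \<longrightarrow> T s p \<notin> leaf_openers)"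

lemma leaf_prefixI:
  assumes "word_at (T s) i (a # u)" "a \<in> {LOpen, LConc}" "set u \<inter> {LOpen, LConc} = {}"
    and "T s (i + int n) \<notin> leaf_openers" "n = length u + 1"
  shows "leaf_prefix s i n"
proof -
  have "T s p \<notin> leaf_openers" if "i < p" "p \<le> i + int n" for p
  proof (cases "p = i + int n")
    case False
    then have "T s p \<in> Input ` set u"
      using assms(1,5) that by (intro word_at_cell_in[of _ "i + 1"]) simp_all
    then show ?thesis using assms(3) by (auto simp: leaf_openers_def)
  qed (use assms(4) in simp)
  then show ?thesis using assms(1,2) by (auto simp: leaf_prefix_def leaf_openers_def)
qed

lemma reach_Back_scan:
  "leaf_prefix s i n \<Longrightarrow>
   reach n (conf (Back s b) (h(s := i + int n))) (conf (Back s b) (h(s := i)))"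
proof (induction n)
  case (Suc n)
  have "reach 1 (conf (Back s b) (h(s := i + int (Suc n)))) (conf (Back s b) (h(s := i + int n)))"
    using Suc.prems by (intro reaches_step) (simp add: step_config leaf_prefix_def)
  also have "reach n \<dots> (conf (Back s b) (h(s := i)))"
    using Suc.prems by (intro Suc.IH) (simp add: leaf_prefix_def)
  finally show ?case by simp
qed (simp add: reaches_refl)

lemma reach_Back:
  assumes "leaf_prefix Lhs j m" "leaf_prefix Rhs i n"
  shows "reach (m + n + 2) (conf (Back Lhs b) (heads (j + int m) (i + int n)))
    (conf (Return Lhs b) (heads j i))"
proof -
  have "reach m (conf (Back Lhs b) (heads (j + int m) (i + int n)))
      (conf (Back Lhs b) (heads j (i + int n)))"
    using reach_Back_scan[OF assms(1), of b "heads j (i + int n)"] by simp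
  also have "reach 1 \<dots> (conf (Back Rhs b) (heads j (i + int n)))"
    using assms(1) by (intro reaches_step) (simp add: step_config leaf_prefix_def)
  also have "reach n \<dots> (conf (Back Rhs b) (heads j i))"
    using reach_Back_scan[OF assms(2), of b "heads j i"] by simp
  also have "reach 1 \<dots> (conf (Return Lhs b) (heads j i))"
    using assms(2) by (intro reaches_step) (simp add: step_config leaf_prefix_def)
  finally show ?thesis by (rule reaches_mono) simp
qed

lemma node_AtomD:
  assumes "node s i (Atom A)"
  shows "T s i = Input LConc" "word_at (T s) (i + 1) (map Dig A)"
    "\<not> is_digit (T s (i + 1 + int (length A)))" "T s (i + 1 + int (length A)) \<noteq> Input LDot"
    "leaf_prefix s i (length A + 1)"
proof -
  show "leaf_prefix s i (length A + 1)"
    using assms by (intro leaf_prefixI[of s i LConc "map Dig A"])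
      (auto simp: node_def leaf_openers_def add_ac)
qed (use assms in \<open>auto simp: node_def is_digit_def add_ac\<close>)

lemma reach_Match_Atom:
  assumes "node Lhs j (Atom A)" "node Rhs i (Atom B)"
  shows "reach (2 * (csize (Atom A) + csize (Atom B)) + 2) (conf Match (heads j i))
    (conf (Return Lhs (A = B)) (heads j i))"
proof -
  note lhs = node_AtomD[OF assms(1)] and rhs = node_AtomD[OF assms(2)]
  let ?j = "j + 1 + int (length A)" and ?i = "i + 1 + int (length B)"
  have "reach 1 (conf Match (heads j i)) (conf (CompareName True) (heads (j + 1) (i + 1)))"
    using lhs(1) rhs(1) by (intro reaches_step) (simp add: step_config)
  also have "reach (length A + length B) \<dots> (conf (CompareName (A = B)) (heads ?j ?i))"
    using reach_CompareName[OF lhs(2,3) rhs(2,3), of True] by simp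
  also have "reach 1 \<dots> (conf (Back Lhs (A = B)) (heads ?j ?i))"
    using lhs(3,4) rhs(3) by (intro reaches_step) (simp add: step_config)
  also have "reach (length A + 1 + (length B + 1) + 2) \<dots> (conf (Return Lhs (A = B)) (heads j i))"
    using reach_Back[OF lhs(5) rhs(5)] by (simp add: add_ac)
  finally show ?thesis by (rule reaches_mono) simp
qed

definition body_offset :: "num \<Rightarrow> name \<Rightarrow> nat" where
  "body_offset k R = length (digits k) + length R + 4"

lemma node_AtLeastD:
  assumes "node s i (AtLeast k R C)"
  defines "p \<equiv> i + int (body_offset k R)"
  shows "T s i = Input LOpen" "T s (i + 1) = Input LGeq"
    "word_at (T s) (i + 2) (map Dig (digits k) @ [LRole])"
    "word_at (T s) (p - 1 - int (length R)) (map Dig R)" "T s (p - 1) = Input LDot"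
    "node s p C" "leaf_prefix s i (body_offset k R - 1)"
proof -
  have "T s i = Input LOpen" "T s (i + 1) = Input LGeq"
    "word_at (T s) (i + 2) (map Dig (digits k) @ [LRole])"
    "word_at (T s) (p - 1 - int (length R)) (map Dig R)" "T s (p - 1) = Input LDot"
    using assms by (simp_all add: node_def body_offset_def add_ac)
  then show "T s i = Input LOpen" "T s (i + 1) = Input LGeq"
    "word_at (T s) (i + 2) (map Dig (digits k) @ [LRole])"
    "word_at (T s) (p - 1 - int (length R)) (map Dig R)" "T s (p - 1) = Input LDot" .
  show "node s p C"
    using assms by (simp add: node_def body_offset_def csize_def add_ac)
  show "leaf_prefix s i (body_offset k R - 1)"
    using assms by (intro leaf_prefixI[of s i LOpen "LGeq # map Dig (digits k) @ LRole # map Dig R"])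
      (auto simp: node_def leaf_openers_def body_offset_def add_ac)
qed

lemma reach_Match_restriction_headers:
  assumes "node Lhs j (AtLeast l S E)" "node Rhs i (AtLeast k R D)"
  defines "j' \<equiv> j + int (body_offset l S)" and "i' \<equiv> i + int (body_offset k R)"
  shows "reach (body_offset l S + body_offset k R) (conf Match (heads j i))
    (conf (CompareName (k \<le> l \<and> S = R)) (heads (j' - 1) (i' - 1)))"
proof -
  note lhs = node_AtLeastD[OF assms(1), folded j'_def]
  note rhs = node_AtLeastD[OF assms(2), folded i'_def]
  have "reach 1 (conf Match (heads j i)) (conf (CompareNum None) (heads (j + 1) (i + 1)))"
    using lhs(1) rhs(1) by (intro reaches_step) (simp add: step_config)
  also have "reach 1 \<dots> (conf (CompareNum None) (heads (j + 2) (i + 2)))"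
    using lhs(2) rhs(2) by (intro reaches_step) (simp add: step_config add_ac)
  also have "reach (length (digits l) + length (digits k) + 1) \<dots>
      (conf (CompareName (k \<le> l)) (heads (j' - 1 - int (length S)) (i' - 1 - int (length R))))"
    using reach_CompareNum[OF lhs(3) rhs(3), of None]
    by (simp add: digits_ge_digits j'_def i'_def body_offset_def add_ac)
  also have "reach (length S + length R) \<dots>
      (conf (CompareName (k \<le> l \<and> S = R)) (heads (j' - 1) (i' - 1)))"
    using reach_CompareName[OF lhs(4) _ rhs(4)] lhs(5) rhs(5) by (simp add: is_digit_def)
  finally show ?thesis by (rule reaches_mono) (simp add: body_offset_def)
qed

definition decides_within :: "nat \<Rightarrow> concept \<Rightarrow> bool" where
  "decides_within K D \<longleftrightarrow> (\<forall>C i j. node Lhs j C \<longrightarrow> node Rhs i D \<longrightarrow>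
     T Lhs (j - 1) \<notin> {Input LOpen, Input LAnd} \<longrightarrow> 2 * (csize C + csize D) + 12 \<le> K \<longrightarrow>
     reach (K * (csize C + 1) * csize D) (conf (Enter Rhs) (heads j i))
       (conf (Return Rhs (covers C D)) (heads j i)))"

lemma reach_CompareName_bodies:
  assumes nodes: "node Lhs j E" "node Rhs i D"
    and dots: "T Lhs (j - 1) = Input LDot" "T Rhs (i - 1) = Input LDot"
    and decides: "decides_within K D" and large: "2 * (csize E + csize D) + 12 \<le> K"
  shows "reach (K * (csize E + 1) * csize D + 3) (conf (CompareName True) (heads (j - 1) (i - 1)))
    (conf (Back Lhs (covers E D)) (heads (j - 1) (i - 1)))"
proof -
  have "reach 1 (conf (CompareName True) (heads (j - 1) (i - 1))) (conf (Enter Rhs) (heads j i))"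
    using dots by (intro reaches_step) (simp add: step_config is_digit_def)
  also have "reach (K * (csize E + 1) * csize D) \<dots> (conf (Return Rhs (covers E D)) (heads j i))"
    using decides nodes dots(1) large by (simp add: decides_within_def)
  also have "reach 1 \<dots> (conf (Ascend Rhs (covers E D)) (heads j (i - 1)))"
    by (intro reaches_step) (simp add: step_config)
  also have "reach 1 \<dots> (conf (Back Lhs (covers E D)) (heads (j - 1) (i - 1)))"
    using dots(2) by (intro reaches_step) (simp add: step_config)
  finally show ?thesis by (rule reaches_mono) simp
qed

lemma reach_Match_AtLeast:
  assumes nodes: "node Lhs j (AtLeast l S E)" "node Rhs i (AtLeast k R D)"
    and decides: "decides_within K D" and large: "2 * (csize E + csize D) + 12 \<le> K"
  defines "b \<equiv> covers (AtLeast l S E) (AtLeast k R D)"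
  shows "reach (K * (csize E + 1) * csize D + 2 * (csize (AtLeast l S E) + csize (AtLeast k R D)))
    (conf Match (heads j i)) (conf (Return Lhs b) (heads j i))"
proof -
  define j' i' where "j' = j + int (body_offset l S)" and "i' = i + int (body_offset k R)"
  note lhs = node_AtLeastD[OF nodes(1), folded j'_def]
  note rhs = node_AtLeastD[OF nodes(2), folded i'_def]
  note reach_Match_restriction_headers[OF nodes, folded j'_def i'_def]
  also have "reach (K * (csize E + 1) * csize D + 3)
      (conf (CompareName (k \<le> l \<and> S = R)) (heads (j' - 1) (i' - 1)))
      (conf (Back Lhs b) (heads (j' - 1) (i' - 1)))"
  proof (cases "k \<le> l \<and> S = R")
    case True
    then show ?thesis
      using reach_CompareName_bodies[OF lhs(6) rhs(6) lhs(5) rhs(5) decides large]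
      by (simp add: b_def)
  next
    case False
    then have "reach 1 (conf (CompareName (k \<le> l \<and> S = R)) (heads (j' - 1) (i' - 1)))
        (conf (Back Lhs b) (heads (j' - 1) (i' - 1)))"
      using lhs(5) rhs(5) by (intro reaches_step) (auto simp: step_config is_digit_def b_def)
    then show ?thesis by (rule reaches_mono) simp
  qed
  also have "reach (body_offset l S + body_offset k R) \<dots> (conf (Return Lhs b) (heads j i))"
    using reach_Back[OF lhs(7) rhs(7), of b] by (simp add: body_offset_def j'_def i'_def add_ac)
  finally show ?thesis by (rule reaches_mono) (simp add: body_offset_def)
qed


subsection \<open>The run on a pair of concepts\<close>

lemma reach_leaf_control:
  assumes "node s i e" "e \<in> conjuncts C"
  shows "reach 2 (conf (Enter s) (h(s := i))) (conf (leaf_control s) (h(s := i)))"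
  using assms(2)
proof (cases rule: conjunct_cases)
  case (Atom A)
  then have "T s i = Input LConc" using assms(1) by (simp add: node_def)
  then have "reach 1 (conf (Enter s) (h(s := i))) (conf (leaf_control s) (h(s := i)))"
    by (intro reaches_step) (simp add: step_config)
  then show ?thesis by (rule reaches_mono) simp
next
  case (AtLeast k R D)
  then have "T s i = Input LOpen" "T s (i + 1) = Input LGeq"
    using assms(1) by (simp_all add: node_def)
  then have "reach 1 (conf (Enter s) (h(s := i))) (conf (Peek s) (h(s := i + 1)))"
    by (intro reaches_step) (simp add: step_config)
  also have "reach 1 \<dots> (conf (leaf_control s) (h(s := i)))"
    using \<open>T s (i + 1) = Input LGeq\<close> by (intro reaches_step) (simp add: step_config)
  finally show ?thesis by (simp add: numeral_2_eq_2)
qed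

lemma reach_Enter_Lhs_different:
  assumes "node Lhs j f" "f \<in> conjuncts C" "T Lhs j \<noteq> T Rhs i"
  shows "reach 3 (conf (Enter Lhs) (heads j i)) (conf (Return Lhs False) (heads j i))"
proof -
  have "reach 2 (conf (Enter Lhs) (heads j i)) (conf Match (heads j i))"
    using reach_leaf_control[OF assms(1,2), of "heads j i"] by simp
  also have "reach 1 \<dots> (conf (Return Lhs False) (heads j i))"
    using assms(3) by (intro reaches_step) (simp add: step_config)
  finally show ?thesis by simp
qed

lemma reach_Enter_Lhs_conjunct:
  assumes nodes: "node Lhs j f" "node Rhs i e" and conjuncts: "f \<in> conjuncts C" "e \<in> conjuncts D"
    and bodies: "\<And>k R D'. e = AtLeast k R D' \<Longrightarrow> decides_within K D'"
    and large: "2 * (csize f + csize e) + 12 \<le> K"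
  shows "reach (K * csize e * csize f) (conf (Enter Lhs) (heads j i))
    (conf (Return Lhs (covers f e)) (heads j i))"
proof -
  have enter: "reach 2 (conf (Enter Lhs) (heads j i)) (conf Match (heads j i))"
    using reach_leaf_control[OF nodes(1) conjuncts(1), of "heads j i"] by simp
  have time: "2 * (csize f + csize e) + 12 \<le> K * csize e * csize f"
    using large le_mult_csize[of K e] le_mult_csize[of "K * csize e" f] by linarith
  show ?thesis
  proof (cases rule: conjunct_cases[OF conjuncts(1)]; cases rule: conjunct_cases[OF conjuncts(2)])
    fix A B assume atoms: "f = Atom A" "e = Atom B"
    note enter
    also note reach_Match_Atom[OF nodes[unfolded atoms]]
    finally show ?thesis
      by (rule reaches_cong) (use time atoms in \<open>auto simp: eq_commute[of A B]\<close>)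
  next
    fix A k R D' assume different: "f = Atom A" "e = AtLeast k R D'"
    then have "T Lhs j \<noteq> T Rhs i" using nodes by (simp add: node_def)
    from reach_Enter_Lhs_different[OF nodes(1) conjuncts(1) this] show ?thesis
      by (rule reaches_cong) (use time different in simp_all)
  next
    fix l S E B assume different: "f = AtLeast l S E" "e = Atom B"
    then have "T Lhs j \<noteq> T Rhs i" using nodes by (simp add: node_def)
    from reach_Enter_Lhs_different[OF nodes(1) conjuncts(1) this] show ?thesis
      by (rule reaches_cong) (use time different in simp_all)
  next
    fix l S E k R D' assume restrictions: "f = AtLeast l S E" "e = AtLeast k R D'"
    have body: "decides_within K D'" "2 * (csize E + csize D') + 12 \<le> K"
      using bodies large restrictions by simp_all
    note enter
    also note reach_Match_AtLeast[OF nodes[unfolded restrictions] body, folded restrictions]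
    finally show ?thesis
      using large unfolding restrictions by (elim reaches_mono) (simp add: algebra_simps)
  qed
qed

lemma reach_Enter_Rhs_conjunct:
  assumes nodes: "node Lhs j C" "node Rhs i e" and conjunct: "e \<in> conjuncts D"
    and root: "T Lhs (j - 1) \<notin> {Input LOpen, Input LAnd}"
    and bodies: "\<And>k R D'. e = AtLeast k R D' \<Longrightarrow> decides_within K D'"
    and large: "2 * (csize C + csize e) + 12 \<le> K"
  shows "reach (K * (csize C + 1) * csize e) (conf (Enter Rhs) (heads j i))
    (conf (Return Rhs (covers C e)) (heads j i))"
proof -
  have time: "2 * (csize C + csize e) + 12 \<le> K * csize e"
    using large le_mult_csize[of K e] by linarith
  have "reach (K * csize e * csize C) (conf (Enter Lhs) ((heads j i)(Lhs := j)))
      (conf (Return Lhs (over_conjuncts Lhs (conjuncts C) (\<lambda>f. covers f e)))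
        ((heads j i)(Lhs := j)))"
  proof (rule reach_Enter_conjuncts[OF nodes(1)])
    show "2 * csize C + 8 \<le> K * csize e" using time by simp
  next
    fix f j' assume f_conjunct: "f \<in> conjuncts C" "node Lhs j' f"
    then have "2 * (csize f + csize e) + 12 \<le> K" using large csize_conjunct_le[of f C] by simp
    then show "reach (K * csize e * csize f) (conf (Enter Lhs) ((heads j i)(Lhs := j')))
        (conf (Return Lhs (covers f e)) ((heads j i)(Lhs := j')))"
      using reach_Enter_Lhs_conjunct[OF f_conjunct(2) nodes(2) f_conjunct(1) conjunct bodies] by simp
  qed
  then have traverse_Lhs: "reach (K * csize e * csize C) (conf (Enter Lhs) (heads j i))
      (conf (Return Lhs (covers C e)) (heads j i))"
    by (simp add: covers_iff_conjuncts_left[OF conjunct, of C])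
  have "reach 2 (conf (Enter Rhs) (heads j i)) (conf (Enter Lhs) (heads j i))"
    using reach_leaf_control[OF nodes(2) conjunct, of "heads j i"] by simp
  also note traverse_Lhs
  also have "reach 1 (conf (Return Lhs (covers C e)) (heads j i))
      (conf (Ascend Lhs (covers C e)) (heads (j - 1) i))"
    by (intro reaches_step) (simp add: step_config)
  also have "reach 1 \<dots> (conf (Return Rhs (covers C e)) (heads j i))"
    using root by (intro reaches_step) (simp add: step_config)
  finally show ?thesis
    by (rule reaches_mono) (use time in \<open>simp add: algebra_simps\<close>)
qed

lemma decides_within: "decides_within K D"
proof (induction "csize D" arbitrary: D rule: less_induct)
  case less
  show ?case unfolding decides_within_def
  proof (intro allI impI)
    fix C i j
    assume nodes: "node Lhs j C" "node Rhs i D"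
      and root: "T Lhs (j - 1) \<notin> {Input LOpen, Input LAnd}"
      and large: "2 * (csize C + csize D) + 12 \<le> K"
    have "reach (K * (csize C + 1) * csize D) (conf (Enter Rhs) ((heads j i)(Rhs := i)))
        (conf (Return Rhs (over_conjuncts Rhs (conjuncts D) (covers C))) ((heads j i)(Rhs := i)))"
    proof (rule reach_Enter_conjuncts[OF nodes(2)])
      show "2 * csize D + 8 \<le> K * (csize C + 1)" using large by simp
    next
      fix e i' assume conjunct: "e \<in> conjuncts D" "node Rhs i' e"
      have "decides_within K D'" if "e = AtLeast k R D'" for k R D'
        using that csize_conjunct_le[OF conjunct(1)] by (intro less) simp
      then have "reach (K * (csize C + 1) * csize e) (conf (Enter Rhs) (heads j i'))
          (conf (Return Rhs (covers C e)) (heads j i'))"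
        using nodes(1) conjunct root large csize_conjunct_le[OF conjunct(1)]
        by (intro reach_Enter_Rhs_conjunct) auto
      then show "reach (K * (csize C + 1) * csize e) (conf (Enter Rhs) ((heads j i)(Rhs := i')))
          (conf (Return Rhs (covers C e)) ((heads j i)(Rhs := i')))" by simp
    qed
    then show "reach (K * (csize C + 1) * csize D) (conf (Enter Rhs) (heads j i))
        (conf (Return Rhs (covers C D)) (heads j i))"
      by (simp add: covers_iff_conjuncts_right[of C D])
  qed
qed

end


subsection \<open>The complete run\<close>

primrec contents :: "letter list \<Rightarrow> letter list \<Rightarrow> side \<Rightarrow> int \<Rightarrow> letter cell" where
  "contents u w Lhs = fst (input_tape u)"
| "contents u w Rhs = fst (input_tape w)"

lemma contents_nth: "n < length w \<Longrightarrow> contents u w Rhs (int n) = Input (w ! n)"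
  by (simp add: input_tape_def)

lemma word_at_input_tape: "word_at (fst (input_tape w)) 0 w"
  by (simp add: word_at_def input_tape_def)

lemma input_tape_snoc: "(fst (input_tape u))(int (length u) := Input a) = fst (input_tape (u @ [a]))"
  by (auto simp: input_tape_def fun_eq_iff nth_append)

lemma LSub_notin_word_of: "LSub \<notin> set (word_of C)"
  by (induction C) auto

lemma reach_Start:
  "reach 1 (initial subsumption_tm w) (conf (contents [] w) Copy (heads 0 0))"
proof (rule reaches_step)
  have "act (scanned tp, MStay) tp = tp" for tp :: "letter tape" by (cases tp) simp
  moreover have "input_tape u = (fst (input_tape u), 0)" for u :: "letter list"
    by (simp add: input_tape_def)
  moreover have "act (Work 0, MStay) (input_tape []) = (origin_mark, 0)"
    by (auto simp: input_tape_def origin_mark_def)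
  ultimately
  show "step subsumption_tm (initial subsumption_tm w) = conf (contents [] w) Copy (heads 0 0)"
    by (simp add: initial_def subsumption_tm_def config_def numeral_2_eq_2)
qed

lemma reach_Copy:
  "LSub \<notin> set u \<Longrightarrow> reach (length u) (conf (contents [] (u @ v)) Copy (heads 0 0))
    (conf (contents u (u @ v)) Copy (heads (int (length u)) (int (length u))))"
proof (induction u arbitrary: v rule: rev_induct)
  case (snoc a u)
  let ?w = "(u @ [a]) @ v" and ?n = "int (length u)"
  have "reach (length u) (conf (contents [] ?w) Copy (heads 0 0))
      (conf (contents u ?w) Copy (heads ?n ?n))"
    using snoc.IH[of "a # v"] snoc.prems by simp
  also have "reach 1 \<dots> (conf (contents (u @ [a]) ?w) Copy (heads (?n + 1) (?n + 1)))"
    using snoc.prems contents_nth[of "length u" ?w u]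
    by (intro reaches_step)
      (auto simp: config_def subsumption_tm_def input_tape_snoc fun_upd_idem nth_append)
  finally show ?case by (simp add: add_ac)
qed (simp add: reaches_refl)

lemma reach_Rewind:
  "n \<le> length u \<Longrightarrow> reach (n + 1) (conf (contents u w) Rewind (heads (int n - 1) i))
    (conf (contents u w) (Enter Rhs) (heads 0 i))"
proof (induction n)
  case 0
  have "reach 1 (conf (contents u w) Rewind (heads (int 0 - 1) i))
      (conf (contents u w) (Enter Rhs) (heads 0 i))"
    by (intro reaches_step) (simp add: step_config input_tape_def)
  then show ?case by simp
next
  case (Suc n)
  have "reach 1 (conf (contents u w) Rewind (heads (int (Suc n) - 1) i))
      (conf (contents u w) Rewind (heads (int n - 1) i))"
    using Suc.prems by (intro reaches_step) (simp add: step_config input_tape_def)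
  also have "reach (n + 1) \<dots> (conf (contents u w) (Enter Rhs) (heads 0 i))" using Suc by simp
  finally show ?case by simp
qed

lemma reach_Enter_root:
  fixes C D :: concept
  defines "w \<equiv> input_word C D"
  defines "T \<equiv> contents (word_of C) w" and "n \<equiv> int (csize C)"
  shows "reach (2 * csize C + 3) (initial subsumption_tm w) (conf T (Enter Rhs) (heads 0 (n + 1)))"
proof -
  have "T Rhs n = Input LSub"
    using contents_nth[of "csize C" w] by (simp add: T_def n_def w_def input_word_def csize_def)
  note reach_Start
  also have "reach (csize C) (conf (contents [] w) Copy (heads 0 0)) (conf T Copy (heads n n))"
    using reach_Copy[OF LSub_notin_word_of, of C "[LSub] @ word_of D"]
    by (simp add: T_def n_def w_def input_word_def csize_def)
  also have "reach 1 \<dots> (conf T Rewind (heads (n - 1) (n + 1)))"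
    using \<open>T Rhs n = Input LSub\<close>
    by (intro reaches_step) (simp add: config_def subsumption_tm_def fun_upd_idem)
  also have "reach (csize C + 1) \<dots> (conf T (Enter Rhs) (heads 0 (n + 1)))"
    unfolding T_def n_def by (rule reach_Rewind) (simp add: csize_def)
  finally show ?thesis by (rule reaches_mono) simp
qed

definition time_bound :: "nat poly" where
  "time_bound = [:5, 2:] + [:12, 2:] * [:1, 1:] * [:0, 1:]"

lemma reach_Halt:
  fixes C D :: concept
  defines "w \<equiv> input_word C D"
  defines "T \<equiv> contents (word_of C) w" and "n \<equiv> int (csize C)"
  shows "reach (poly time_bound (csize C + csize D)) (initial subsumption_tm w)
    (conf T (Halt (covers C D)) (heads 0 n))"
proof -
  let ?m = "csize C + csize D" and ?b = "covers C D"
  define K where "K = 2 * ?m + 12"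
  have "node T Lhs 0 C"
    using word_at_input_tape[of "word_of C"] by (simp add: node_def T_def input_tape_def csize_def)
  moreover have "T Lhs (0 - 1) = Blank" by (simp add: T_def input_tape_def)
  moreover have rhs: "node T Rhs (n + 1) D" "T Rhs n = Input LSub"
    using word_at_input_tape[of w]
    by (simp_all add: node_def T_def n_def w_def input_word_def input_tape_def csize_def)
  ultimately have decide: "reach (K * (csize C + 1) * csize D)
      (conf T (Enter Rhs) (heads 0 (n + 1))) (conf T (Return Rhs ?b) (heads 0 (n + 1)))"
    using decides_within[of T K D] by (simp add: decides_within_def K_def)
  note reach_Enter_root[of C D, folded w_def, folded T_def n_def]
  also note decide
  also have "reach 1 (conf T (Return Rhs ?b) (heads 0 (n + 1))) (conf T (Ascend Rhs ?b) (heads 0 n))"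
    by (intro reaches_step) (simp add: step_config)
  also have "reach 1 \<dots> (conf T (Halt ?b) (heads 0 n))"
    using rhs(2) by (intro reaches_step) (simp add: step_config)
  finally show ?thesis
  proof (rule reaches_mono)
    have "K * (csize C + 1) * csize D \<le> K * (?m + 1) * ?m" by (intro mult_le_mono) simp_all
    then have "2 * csize C + 3 + K * (csize C + 1) * csize D + 1 + 1
        \<le> 2 * ?m + 5 + K * (?m + 1) * ?m"
      by simp
    also have "\<dots> = poly time_bound ?m" by (simp add: time_bound_def K_def algebra_simps)
    finally show "2 * csize C + 3 + K * (csize C + 1) * csize D + 1 + 1 \<le> poly time_bound ?m" .
  qed
qed

theorem theorem8:
  "\<exists>(M :: letter tm) (p :: nat poly). turing_machine M \<and>
     (\<forall>C C'.
        (subsumed C C' \<longrightarrow> accepts_within M (input_word C C') (poly p (csize C + csize C'))) \<and>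
        (\<not> subsumed C C' \<longrightarrow> rejects_within M (input_word C C') (poly p (csize C + csize C'))))"
proof (intro exI conjI allI)
  show "turing_machine subsumption_tm" by (rule turing_machine_subsumption_tm)
next
  fix C C'
  let ?n = "poly time_bound (csize C + csize C')"
  obtain t where "t \<le> ?n"
    and "fst ((step subsumption_tm ^^ t) (initial subsumption_tm (input_word C C'))) =
      to_nat (Halt (covers C C'))"
    using reach_Halt[of C C'] by (auto simp: reaches_def config_def)
  moreover have "accept subsumption_tm = to_nat (Halt True)"
    "reject subsumption_tm = to_nat (Halt False)"
    by (simp_all add: subsumption_tm_def)
  ultimately show "subsumed C C' \<longrightarrow> accepts_within subsumption_tm (input_word C C') ?n"
    and "\<not> subsumed C C' \<longrightarrow> rejects_within subsumption_tm (input_word C C') ?n"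
    unfolding subsumed_iff_covers accepts_within_def rejects_within_def by auto
qed

end
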